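(* Let $X$ be a real Banach space, let $f:X\to\mathbb{R}$ be locally Lipschitz continuous, let $h_k\to h$ in $X$, and let $A_k,A\subset X$ ($k\in\mathbb{N}$) be nonempty with $A$ compact and $A_k\to A$ in the Hausdorff metric, i.e. $$d(A_k,A):=\inf\{\delta>0\mid A\subset B_\delta(A_k)\ \text{and}\ A_k\subset B_\delta(A)\}\to 0\quad\text{as }k\to\infty.$$ Then $$\limsup_{k\to\infty}f^0(A_k;h_k)\le f^0(A;h)$$ and $$\{a\in X^*\mid \text{there are } a_k\in\partial f(A_k)\ (k\in\mathbb{N})\ \text{with } a_k\rightharpoonup^* a\}\subset\partial f(A).$$ If $A\subset A_k$ for all $k\in\mathbb{N}$, then equality holds in the last inclusion and $$\lim_{k\to\infty}f^0(A_k;h_k)=f^0(A;h).$$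
   Context: $X^*$ is the dual of $X$, $\langle\cdot,\cdot\rangle$ the duality pairing, $\rightharpoonup^*$ denotes weak$^*$ convergence of sequences in $X^*$, and $B_\delta(M)$ is the open $\delta$-neighborhood of a set $M$. For $f$ Lipschitz near $x$, Clarke's generalized directional derivative is $f^0(x;h)=\limsup_{y\to x,\,t\downarrow 0}\frac{f(y+th)-f(y)}{t}$ and Clarke's generalized gradient is $\partial f(x)=\{a\in X^*\mid\langle a,h\rangle\le f^0(x;h)\ \forall h\in X\}$. For nonempty $A\subset X$, the gradient of $f$ on $A$ is $\partial f(A):=\overline{\operatorname{conv}}^*\bigcup_{y\in A}\partial f(y)$ (the weak$^*$ closure of the convex hull), and the directional derivative of $f$ on $A$ in direction $h\in X$ is $f^0(A;h):=\sup_{y\in A}f^0(y;h)$ (a priori possibly $+\infty$). *)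

theory Defs
  imports "HOL-Analysis.Analysis"
begin

definition locally_lipschitz :: "('a::metric_space \<Rightarrow> 'b::metric_space) \<Rightarrow> bool" where
  "locally_lipschitz f \<longleftrightarrow> (\<forall>x. \<exists>\<delta>>0. \<exists>L. lipschitz_on L (ball x \<delta>) f)"

text \<open>The dual of \<open>X = 'a\<close> is \<open>'a \<Rightarrow>\<^sub>L real\<close>, and the duality pairing of \<open>a\<close> and \<open>h\<close> is
  \<open>blinfun_apply a h\<close>. For real-valued operators the topology of pointwise convergence, called
  strong operator topology in the library, is the weak* topology.\<close>

abbreviation weak_star_topology :: "('a::real_normed_vector \<Rightarrow>\<^sub>L real) topology" where
  "weak_star_topology \<equiv> strong_operator_topology"

lemma limitin_weak_star_iff:
  "limitin weak_star_topology a l F \<longleftrightarrow> (\<forall>h. ((\<lambda>k. blinfun_apply (a k) h) \<longlongrightarrow> blinfun_apply l h) F)"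
proof
  assume lim: "limitin weak_star_topology a l F"
  show "\<forall>h. ((\<lambda>k. blinfun_apply (a k) h) \<longlongrightarrow> blinfun_apply l h) F"
  proof
    fix h
    show "((\<lambda>k. blinfun_apply (a k) h) \<longlongrightarrow> blinfun_apply l h) F"
      using continuous_map_limit[OF strong_operator_topology_continuous_evaluation[of h] lim]
      by (simp add: o_def)
  qed
next
  assume lim: "\<forall>h. ((\<lambda>k. blinfun_apply (a k) h) \<longlongrightarrow> blinfun_apply l h) F"
  have "limitin euclidean (\<lambda>k. blinfun_apply (a k)) (blinfun_apply l) F"
    using lim
    by (simp add: euclidean_product_topology[symmetric] limitin_componentwise)
  then show "limitin weak_star_topology a l F"
    unfolding limitin_def strong_operator_topology_topspace
    by (auto simp: strong_operator_topology_def openin_pullback_topology)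
qed

text \<open>The limit superior is taken in the extended reals, so that it is meaningful for every \<open>f\<close>;
  it is finite where \<open>f\<close> is Lipschitz nearby. The point \<open>y = x\<close> is admitted in \<open>y \<rightarrow> x\<close>.\<close>

definition clarke_dderiv :: "('a::real_normed_vector \<Rightarrow> real) \<Rightarrow> 'a \<Rightarrow> 'a \<Rightarrow> ereal" where
  "clarke_dderiv f x h =
     Limsup (nhds x \<times>\<^sub>F at_right 0) (\<lambda>(y, t). ereal ((f (y + t *\<^sub>R h) - f y) / t))"

definition clarke_gradient :: "('a::real_normed_vector \<Rightarrow> real) \<Rightarrow> 'a \<Rightarrow> ('a \<Rightarrow>\<^sub>L real) set" where
  "clarke_gradient f x = {a. \<forall>h. ereal (blinfun_apply a h) \<le> clarke_dderiv f x h}"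

definition clarke_gradient_on ::
    "('a::real_normed_vector \<Rightarrow> real) \<Rightarrow> 'a set \<Rightarrow> ('a \<Rightarrow>\<^sub>L real) set" where
  "clarke_gradient_on f A =
     weak_star_topology closure_of (convex hull (\<Union>y\<in>A. clarke_gradient f y))"

definition clarke_dderiv_on ::
    "('a::real_normed_vector \<Rightarrow> real) \<Rightarrow> 'a set \<Rightarrow> 'a \<Rightarrow> ereal" where
  "clarke_dderiv_on f A h = (SUP y\<in>A. clarke_dderiv f y h)"

definition set_neighborhood :: "real \<Rightarrow> 'a::metric_space set \<Rightarrow> 'a set" where
  "set_neighborhood \<delta> M = (\<Union>m\<in>M. ball m \<delta>)"

text \<open>The value is \<open>\<infinity>\<close> if no \<open>\<delta>\<close> is admissible, which can happen for unbounded sets.\<close>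

definition hausdorff_distance :: "'a::metric_space set \<Rightarrow> 'a set \<Rightarrow> ereal" where
  "hausdorff_distance A B =
     Inf {ereal \<delta> | \<delta>. \<delta> > 0 \<and> B \<subseteq> set_neighborhood \<delta> A \<and> A \<subseteq> set_neighborhood \<delta> B}"

end

theory Submission
  imports Defs
begin

text \<open>The directional derivative \<open>f\<^sup>0(x;h)\<close> is finite and sublinear in \<open>h\<close>, and jointly upper
  semicontinuous in \<open>(x, h)\<close>; compactness of \<open>A\<close> makes the upper estimate uniform on a neighborhood
  of \<open>A \<times> {h}\<close>, which gives the bound on the limit superior. By Hahn--Banach \<open>f\<^sup>0(x;h)\<close> is the
  maximum of \<open>\<langle>a, h\<rangle>\<close> over the gradient at \<open>x\<close>, so weak* separation identifies \<open>\<partial>f(A)\<close> as the set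
  of all \<open>a\<close> with \<open>\<langle>a, h\<rangle> \<le> f\<^sup>0(A;h)\<close> for every \<open>h\<close>, and this inequality survives weak* limits.\<close>

subsection \<open>Sublinear functionals and separation\<close>

text \<open>Factors are strictly positive because these are the ones by which difference quotients
  rescale; the value \<open>0\<close> at \<open>0\<close> follows from
  \<open>p (2 *\<^sub>R 0) = 2 * p 0\<close>.\<close>

definition sublinear :: "('a::real_vector \<Rightarrow> real) \<Rightarrow> bool" where
  "sublinear p \<longleftrightarrow> (\<forall>x y. p (x + y) \<le> p x + p y) \<and> (\<forall>c x. 0 < c \<longrightarrow> p (c *\<^sub>R x) = c * p x)"

lemma sublinear_add: "sublinear p \<Longrightarrow> p (x + y) \<le> p x + p y"
  and sublinear_scale_pos: "sublinear p \<Longrightarrow> 0 < c \<Longrightarrow> p (c *\<^sub>R x) = c * p x"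
  by (auto simp: sublinear_def)

lemma sublinear_zero: "sublinear p \<Longrightarrow> p 0 = 0"
  using sublinear_scale_pos[of p 2 0] by simp

lemma sublinear_scale: "sublinear p \<Longrightarrow> 0 \<le> c \<Longrightarrow> p (c *\<^sub>R x) = c * p x"
  using sublinear_scale_pos[of p c x] sublinear_zero[of p] by (cases "c = 0") auto

lemma sublinear_minus: "sublinear p \<Longrightarrow> - p (- x) \<le> p x"
  using sublinear_add[of p x "- x"] sublinear_zero[of p] by simp

text \<open>Take the infimum of \<open>p (y + t *\<^sub>R x) - t * p x\<close> over
  \<open>t \<ge> 0\<close>. It is finite since \<open>t * p x = p (t *\<^sub>R x) \<le> p (y + t
  *\<^sub>R x) + p (- y)\<close>; \<open>t = 0\<close> gives \<open>q \<le> p\<close>, and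
  \<open>t = 1\<close> at \<open>- x\<close> gives the reflected bound.\<close>

lemma sublinear_below_reflected:
  fixes p :: "'a::real_vector \<Rightarrow> real"
  assumes p: "sublinear p"
  obtains q where "sublinear q" "q \<le> p" "q (- x) \<le> - p x"
proof
  define g where "g y t = p (y + t *\<^sub>R x) - t * p x" for y t
  define q where "q y = (INF t\<in>{0..}. g y t)" for y
  have "- p (- y) \<le> g y t" if "0 \<le> t" for y t
    using sublinear_add[OF p, of "y + t *\<^sub>R x" "- y"] sublinear_scale[OF p that, of x]
    by (simp add: g_def)
  then have bdd: "bdd_below (g y ` {0..})" for y
    by (intro bdd_belowI2[where m = "- p (- y)"]) auto
  have q_le: "q y \<le> g y t" if "0 \<le> t" for y t
    unfolding q_def using that by (intro cINF_lower bdd) auto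
  have le_q: "r \<le> q y" if "\<And>t. 0 \<le> t \<Longrightarrow> r \<le> g y t" for r y
    unfolding q_def using that by (intro cINF_greatest) auto
  show "q \<le> p"
    using q_le[of 0] by (auto simp: le_fun_def g_def)
  show "q (- x) \<le> - p x"
    using q_le[of 1 "- x"] sublinear_zero[OF p] by (simp add: g_def)
  have add: "q (y + z) \<le> q y + q z" for y z
  proof -
    \<comment> \<open>The parameters add up: \<open>s + t\<close> is a competitor for
      \<open>y + z\<close>. The infima over \<open>s\<close> and \<open>t\<close> are then taken one
      after the other.\<close>
    have *: "q (y + z) \<le> g y s + g z t" if "0 \<le> s" "0 \<le> t" for s t
      using q_le[of "s + t" "y + z"] sublinear_add[OF p, of "y + s *\<^sub>R x" "z + t *\<^sub>R x"] that
      by (simp add: g_def algebra_simps)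
    have "q (y + z) - g z t \<le> q y" if "0 \<le> t" for t
      using * that by (intro le_q) (simp add: algebra_simps)
    then have "q (y + z) - q y \<le> q z"
      by (intro le_q) (simp add: algebra_simps)
    then show ?thesis by simp
  qed
  \<comment> \<open>The substitution \<open>t / c\<close> gives one inequality; the reverse is the
    same inequality for the factor \<open>inverse c\<close>.\<close>
  have scale_le: "c * q y \<le> q (c *\<^sub>R y)" if c: "0 < c" for c y
  proof (rule le_q)
    fix t :: real assume "0 \<le> t"
    then have "c * q y \<le> c * g y (t / c)"
      using c by (intro mult_left_mono q_le) auto
    also have "\<dots> = g (c *\<^sub>R y) t"
      using sublinear_scale_pos[OF p c, of "y + (t / c) *\<^sub>R x"] c
      by (simp add: g_def algebra_simps)
    finally show "c * q y \<le> g (c *\<^sub>R y) t" .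
  qed
  have "q (c *\<^sub>R y) = c * q y" if c: "0 < c" for c y
  proof (rule antisym)
    have "inverse c * q (c *\<^sub>R y) \<le> q (inverse c *\<^sub>R c *\<^sub>R y)"
      using c by (intro scale_le) simp
    then show "q (c *\<^sub>R y) \<le> c * q y"
      using c by (simp add: field_simps)
  qed (rule scale_le[OF c])
  with add show "sublinear q"
    by (auto simp: sublinear_def)
qed

text \<open>The pointwise infimum works. It is finite because
  \<open>- p (- x) \<le> - q (- x) \<le> q x\<close>, and it is subadditive because the smaller of
  two chain members serves for both summands.\<close>

lemma sublinear_INF_chain:
  fixes C :: "('a::real_vector \<Rightarrow> real) set"
  assumes "C \<noteq> {}" and sub: "\<And>q. q \<in> C \<Longrightarrow> sublinear q" and le: "\<And>q. q \<in> C \<Longrightarrow> q \<le> p"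
    and chain: "\<And>q r. q \<in> C \<Longrightarrow> r \<in> C \<Longrightarrow> q \<le> r \<or> r \<le> q"
  obtains u where "sublinear u" "\<And>q. q \<in> C \<Longrightarrow> u \<le> q"
proof
  define u where "u x = (INF q\<in>C. q x)" for x
  have "- p (- x) \<le> q x" if "q \<in> C" for q x
    using sublinear_minus[OF sub[OF that], of x] le_funD[OF le[OF that], of "- x"] by linarith
  then have bdd: "bdd_below ((\<lambda>q. q x) ` C)" for x
    by (intro bdd_belowI2[where m = "- p (- x)"]) auto
  have u_le: "u x \<le> q x" if "q \<in> C" for q x
    unfolding u_def using that by (intro cINF_lower bdd)
  have le_u: "r \<le> u x" if "\<And>q. q \<in> C \<Longrightarrow> r \<le> q x" for r x
    unfolding u_def using that \<open>C \<noteq> {}\<close> by (intro cINF_greatest)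
  show "u \<le> q" if "q \<in> C" for q
    using u_le[OF that] by (simp add: le_fun_def)
  have "u (x + y) \<le> u x + u y" for x y
  proof -
    have *: "u (x + y) \<le> q x + r y" if qr: "q \<in> C" "r \<in> C" for q r
    proof -
      obtain s where s: "s \<in> C" "s \<le> q" "s \<le> r"
        using chain[OF qr] qr by blast
      then show ?thesis
        using u_le[OF s(1), of "x + y"] sublinear_add[OF sub[OF s(1)], of x y]
        by (smt (verit) le_funD)
    qed
    have "u (x + y) - r y \<le> u x" if "r \<in> C" for r
      using * that by (intro le_u) (simp add: algebra_simps)
    then have "u (x + y) - u x \<le> u y"
      by (intro le_u) (simp add: algebra_simps)
    then show ?thesis by simp
  qed
  moreover have "u (c *\<^sub>R x) = c * u x" if c: "0 < c" for c x
  proof (rule antisym)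
    have "u (c *\<^sub>R x) / c \<le> u x"
      using u_le[of _ "c *\<^sub>R x"] sublinear_scale_pos[OF sub c] c
      by (intro le_u) (simp add: field_simps)
    then show "u (c *\<^sub>R x) \<le> c * u x"
      using c by (simp add: field_simps)
    have "c * u x \<le> q (c *\<^sub>R x)" if "q \<in> C" for q
      using mult_left_mono[OF u_le[OF that, of x], of c] sublinear_scale_pos[OF sub[OF that] c, of x] c
      by simp
    then show "c * u x \<le> u (c *\<^sub>R x)"
      by (rule le_u)
  qed
  ultimately show "sublinear u"
    by (simp add: sublinear_def)
qed

text \<open>A minimal sublinear functional is linear, and Zorn's lemma supplies one below \<open>p\<close>.
  Starting from a \<open>p' \<le> p\<close> with \<open>p' (- x) \<le> - p x\<close> forces equality at \<open>x\<close>.\<close>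

theorem Hahn_Banach_supporting_functional:
  fixes p :: "'a::real_vector \<Rightarrow> real"
  assumes p: "sublinear p"
  obtains g where "linear g" "g \<le> p" "g x = p x"
proof -
  obtain p' where p': "sublinear p'" "p' \<le> p" "p' (- x) \<le> - p x"
    using sublinear_below_reflected[OF p] .
  define S where "S = {q. sublinear q \<and> q \<le> p'}"
  \<comment> \<open>Zorn's lemma is applied to the reversed order, so a maximal element is a minimal
    functional.\<close>
  have "\<exists>g\<in>S. \<forall>q\<in>S. q \<le> g \<longrightarrow> q = g"
  proof (rule predicate_Zorn)
    show "partial_order_on S (relation_of (\<lambda>q r. r \<le> q) S)"
      by (auto simp: partial_order_on_def preorder_on_def refl_on_def trans_def antisym_def
          relation_of_def intro: order_trans)
    fix C assume "C \<in> Chains (relation_of (\<lambda>q r. r \<le> q) S)"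
    then have C: "q \<in> S" "q \<le> r \<or> r \<le> q" if "q \<in> C" "r \<in> C" for q r
      using that by (auto simp: Chains_def relation_of_def)
    show "\<exists>u\<in>S. \<forall>q\<in>C. u \<le> q"
    proof (cases "C = {}")
      case True
      then show ?thesis using p'(1) by (auto simp: S_def)
    next
      case False
      obtain u where u: "sublinear u" "\<And>q. q \<in> C \<Longrightarrow> u \<le> q"
      proof (rule sublinear_INF_chain[OF False])
        show "sublinear q" "q \<le> p'" if "q \<in> C" for q
          using C(1)[OF that that] by (auto simp: S_def)
      qed (use C(2) in auto)
      moreover from False obtain q where "q \<in> C" by auto
      ultimately have "u \<in> S"
        using C(1)[of q q] order_trans[of u q p'] by (auto simp: S_def)
      with u(2) show ?thesis by blast
    qed
  qed
  then obtain g where g: "sublinear g" "g \<le> p'" and min: "\<And>q. sublinear q \<Longrightarrow> q \<le> g \<Longrightarrow> q = g"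
    unfolding S_def by (auto intro: order_trans)
  \<comment> \<open>The reflected functional lies below \<open>g\<close>, hence equals
    \<open>g\<close> by minimality; so \<open>g\<close> is odd, and an odd sublinear functional is
    linear.\<close>
  have minus: "g (- y) = - g y" for y
  proof (rule antisym)
    obtain q where "sublinear q" "q \<le> g" "q (- y) \<le> - g y"
      using sublinear_below_reflected[OF g(1)] .
    then show "g (- y) \<le> - g y"
      using min by metis
    show "- g y \<le> g (- y)"
      using sublinear_minus[OF g(1), of "- y"] by simp
  qed
  have add: "g (y + z) = g y + g z" for y z
    using sublinear_add[OF g(1), of y z] sublinear_add[OF g(1), of "y + z" "- z"] minus[of z]
    by simp
  have "g (c *\<^sub>R y) = c * g y" for c y
  proof (cases "0 \<le> c")
    case False
    then show ?thesis
      using sublinear_scale[OF g(1), of "- c" y] minus[of "c *\<^sub>R y"] by simp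
  qed (rule sublinear_scale[OF g(1)])
  with add have "linear g"
    by (simp add: linear_iff)
  moreover have "g \<le> p"
    using g(2) p'(2) by (rule order_trans)
  moreover have "g (- x) \<le> - p x"
    using g(2) p'(3) by (metis le_funD order_trans)
  then have "g x = p x"
    using minus[of x] le_funD[OF \<open>g \<le> p\<close>, of x] by simp
  ultimately show thesis ..
qed

section \<open>Weak* neighborhoods and separation\<close>

text \<open>The topology is pulled back from the product topology on functions, whose basic open
  sets restrict only finitely many coordinates; one radius is the minimum of the finitely many
  coordinate radii.\<close>

lemma weak_star_neighborhood:
  fixes a :: "'a::real_normed_vector \<Rightarrow>\<^sub>L real"
  assumes "openin weak_star_topology U" "a \<in> U"
  obtains H e where "finite H" "e > 0"
    "\<And>c. (\<And>x. x \<in> H \<Longrightarrow> \<bar>blinfun_apply c x - blinfun_apply a x\<bar> < e) \<Longrightarrow> c \<in> U"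
proof -
  obtain V where V: "open V" "U = blinfun_apply -` V"
    using assms(1) by (auto simp: strong_operator_topology_def openin_pullback_topology)
  then have "openin (product_topology (\<lambda>i. euclidean) UNIV) V"
    by (metis open_openin euclidean_product_topology)
  then obtain W where W: "finite {i. W i \<noteq> (UNIV :: real set)}" "\<And>i. open (W i)"
    "blinfun_apply a \<in> Pi\<^sub>E UNIV W" "Pi\<^sub>E UNIV W \<subseteq> V"
    using product_topology_open_contains_basis[of "\<lambda>i. euclidean" UNIV V "blinfun_apply a"] V assms(2)
    by (auto simp flip: open_openin)
  define H where "H = {i. W i \<noteq> UNIV}"
  have "\<exists>e>0. \<forall>r. \<bar>r - blinfun_apply a i\<bar> < e \<longrightarrow> r \<in> W i" for i
    using W(2)[of i] W(3) unfolding open_dist dist_real_def by (auto simp: PiE_iff)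
  then obtain e where e: "\<And>i. e i > 0" "\<And>i r. \<bar>r - blinfun_apply a i\<bar> < e i \<Longrightarrow> r \<in> W i"
    by metis
  show thesis
  proof
    show "finite H" unfolding H_def by fact
    \<comment> \<open>Inserting \<open>1\<close> keeps the minimum meaningful and positive when
      \<open>H\<close> is empty.\<close>
    define d where "d = Min (insert 1 (e ` H))"
    show "d > 0" using \<open>finite H\<close> e(1) by (auto simp: d_def)
    fix c assume c: "\<And>x. x \<in> H \<Longrightarrow> \<bar>blinfun_apply c x - blinfun_apply a x\<bar> < d"
    have "blinfun_apply c i \<in> W i" for i
    proof (cases "i \<in> H")
      case True
      then have "d \<le> e i" using \<open>finite H\<close> by (auto simp: d_def)
      with c[OF True] show ?thesis by (intro e(2)) auto
    qed (simp add: H_def)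
    then show "c \<in> U" using V W(4) by (auto simp: PiE_def Pi_def)
  qed
qed

text \<open>Only finitely many evaluations \<open>x \<in> H\<close> matter. A near-minimizer \<open>c0\<close> of the squared distance
  \<open>Q\<close> to \<open>a\<close> in these coordinates almost satisfies the first-order condition for a projection;
  boundedness controls the second-order term.\<close>

theorem weak_star_separation:
  fixes S :: "('a::real_normed_vector \<Rightarrow>\<^sub>L real) set"
  assumes "convex S" and "S \<noteq> {}" and bdd: "\<And>x. bounded ((\<lambda>c. blinfun_apply c x) ` S)"
    and a: "a \<notin> weak_star_topology closure_of S"
  obtains x e where "e > 0" "\<And>c. c \<in> S \<Longrightarrow> blinfun_apply c x + e \<le> blinfun_apply a x"
proof -
  obtain U where U: "openin weak_star_topology U" "a \<in> U" "U \<inter> S = {}"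
    using a by (auto simp: in_closure_of strong_operator_topology_topspace)
  obtain H e where H: "finite H" "e > 0"
    and HU: "\<And>c. (\<And>x. x \<in> H \<Longrightarrow> \<bar>blinfun_apply c x - blinfun_apply a x\<bar> < e) \<Longrightarrow> c \<in> U"
    using weak_star_neighborhood[OF U(1,2)] by metis
  define D where "D c x = blinfun_apply c x - blinfun_apply a x" for c x
  define Q where "Q c = (\<Sum>x\<in>H. (D c x)\<^sup>2)" for c
  define m where "m = (INF c\<in>S. Q c)"
  have "e\<^sup>2 \<le> Q c" if "c \<in> S" for c
  proof -
    have "c \<notin> U" using U(3) that by auto
    then obtain x where x: "x \<in> H" "e \<le> \<bar>D c x\<bar>"
      using HU[of c] by (force simp: D_def)
    have "e\<^sup>2 \<le> (D c x)\<^sup>2"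
      using x(2) H(2) by (metis abs_le_square_iff abs_of_pos)
    also have "\<dots> \<le> Q c"
      unfolding Q_def using H(1) x(1) by (intro member_le_sum) auto
    finally show ?thesis .
  qed
  then have "e\<^sup>2 \<le> m"
    unfolding m_def using \<open>S \<noteq> {}\<close> by (intro cINF_greatest)
  then have "m > 0"
    using H(2) by (smt (verit) zero_less_power2)
  have m_le: "m \<le> Q c" if "c \<in> S" for c
    unfolding m_def using that
    by (intro cINF_lower bdd_belowI2[where m = 0]) (auto simp: Q_def sum_nonneg)
  obtain K where K: "\<And>c x. c \<in> S \<Longrightarrow> \<bar>blinfun_apply c x\<bar> \<le> K x"
    using bdd unfolding bounded_real by (metis image_eqI)
  \<comment> \<open>\<open>M\<close> bounds the squared diameter of \<open>S\<close> in the
    coordinates \<open>H\<close>; the summand \<open>1\<close> makes it positive, so that it can be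
    a divisor.\<close>
  define M where "M = (\<Sum>x\<in>H. (2 * K x)\<^sup>2) + 1"
  have "M > 0" by (simp add: M_def add_nonneg_pos sum_nonneg)
  have M: "(\<Sum>x\<in>H. (D c x - D d x)\<^sup>2) \<le> M" if "c \<in> S" "d \<in> S" for c d
  proof -
    have "(D c x - D d x)\<^sup>2 \<le> (2 * K x)\<^sup>2" for x
      using K[OF that(1), of x] K[OF that(2), of x]
      by (subst abs_le_square_iff[symmetric]) (simp add: D_def)
    then have "(\<Sum>x\<in>H. (D c x - D d x)\<^sup>2) \<le> (\<Sum>x\<in>H. (2 * K x)\<^sup>2)"
      by (intro sum_mono) auto
    then show ?thesis by (simp add: M_def)
  qed
  \<comment> \<open>The step length is fixed before \<open>c0\<close>, so that both the second-order
    term \<open>t\<^sup>2 * M\<close> and the slack in the choice of \<open>c0\<close> are at most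
    \<open>t * m / 2\<close>. Dividing by \<open>t\<close> then leaves
    \<open>0 \<le> m + 2 * B\<close>.\<close>
  define t where "t = min 1 (m / (2 * M))"
  have t: "0 < t" "t \<le> 1" "t * M \<le> m / 2"
    using \<open>m > 0\<close> \<open>M > 0\<close> by (auto simp: t_def min_def field_simps)
  obtain c0 where c0: "c0 \<in> S" "Q c0 < m + t * m / 2"
    using cInf_lessD[of "Q ` S" "m + t * m / 2"] \<open>S \<noteq> {}\<close> \<open>m > 0\<close> t(1)
    by (auto simp: m_def)
  \<comment> \<open>Up to a factor this is the negative gradient of \<open>Q\<close> at
    \<open>c0\<close>, read as a vector of the underlying space. It gives
    \<open>\<langle>a - c, x\<rangle> = Q c0 + B\<close>, which is at least
    \<open>m - m / 2\<close>.\<close>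
  define x where "x = (\<Sum>y\<in>H. - D c0 y *\<^sub>R y)"
  show thesis
  proof
    show "m / 2 > 0" using \<open>m > 0\<close> by simp
    fix c assume c: "c \<in> S"
    define B where "B = (\<Sum>y\<in>H. D c0 y * (D c y - D c0 y))"
    have D_eq: "D ((1 - t) *\<^sub>R c0 + t *\<^sub>R c) y = D c0 y + t * (D c y - D c0 y)" for y
      unfolding D_def plus_blinfun.rep_eq scaleR_blinfun.rep_eq by (simp add: algebra_simps)
    have "(1 - t) *\<^sub>R c0 + t *\<^sub>R c \<in> S"
      using \<open>convex S\<close> c c0(1) t by (intro convexD) auto
    then have "m \<le> Q ((1 - t) *\<^sub>R c0 + t *\<^sub>R c)" by (rule m_le)
    also have "\<dots> = (\<Sum>y\<in>H. (D c0 y)\<^sup>2 + 2 * t * (D c0 y * (D c y - D c0 y)) + t\<^sup>2 * (D c y - D c0 y)\<^sup>2)"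
      unfolding Q_def D_eq by (intro sum.cong) (simp_all add: power2_eq_square algebra_simps)
    also have "\<dots> = Q c0 + 2 * t * B + t\<^sup>2 * (\<Sum>y\<in>H. (D c y - D c0 y)\<^sup>2)"
      by (simp add: sum.distrib sum_distrib_left Q_def B_def)
    also have "\<dots> \<le> Q c0 + 2 * t * B + t\<^sup>2 * M"
      using M[OF c c0(1)] by (simp add: mult_left_mono)
    also have "\<dots> \<le> m + t * m / 2 + 2 * t * B + t * (m / 2)"
    proof -
      have "t\<^sup>2 * M \<le> t * (m / 2)"
        using mult_left_mono[OF t(3), of t] t(1) unfolding power2_eq_square mult.assoc by linarith
      with c0(2) show ?thesis by linarith
    qed
    finally have "0 \<le> t * (m + 2 * B)" by (simp add: algebra_simps)
    then have "- (m / 2) \<le> B" using t(1) by (simp add: zero_le_mult_iff)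
    moreover have "blinfun_apply a x - blinfun_apply c x = Q c0 + B"
      by (simp add: x_def blinfun.sum_right blinfun.scaleR_right blinfun.minus_right Q_def B_def D_def power2_eq_square
          flip: sum.distrib sum_subtractf) (auto intro!: sum.cong simp: algebra_simps)
    ultimately show "blinfun_apply c x + m / 2 \<le> blinfun_apply a x"
      using m_le[OF c0(1)] by simp
  qed
qed

subsection \<open>Clarke derivatives and gradients\<close>

text \<open>The map \<open>(y, t) \<mapsto> (y + t *\<^sub>R h, t)\<close> carries the filter into
  itself. This permits a base point that moves with \<open>t\<close>, as in the splitting of an
  increment along \<open>h + g\<close>.\<close>

lemma eventually_nhds_at_right_translate:
  fixes x h :: "'a::real_normed_vector"
  assumes "\<forall>\<^sub>F (y, t) in nhds x \<times>\<^sub>F at_right (0::real). P y t"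
  shows "\<forall>\<^sub>F (y, t) in nhds x \<times>\<^sub>F at_right 0. P (y + t *\<^sub>R h) t"
proof -
  let ?F = "nhds x \<times>\<^sub>F at_right (0::real)"
  have y: "(fst \<longlongrightarrow> x) ?F" and t: "filterlim snd (at_right 0) ?F"
    by (rule filterlim_fst filterlim_snd)+
  from t have "(snd \<longlongrightarrow> 0) ?F"
    by (rule filterlim_mono) (auto simp: at_within_le_nhds)
  with y have "((\<lambda>z. fst z + snd z *\<^sub>R h) \<longlongrightarrow> x + 0 *\<^sub>R h) ?F"
    by (intro tendsto_intros)
  then have "filterlim (\<lambda>z. (fst z + snd z *\<^sub>R h, snd z)) ?F ?F"
    using t by (intro filterlim_Pair) simp_all
  from eventually_compose_filterlim[OF assms this] show ?thesis
    by (simp add: case_prod_unfold)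
qed

lemma eventually_nhds_at_right_scale:
  fixes x :: "'a::real_normed_vector"
  assumes "\<forall>\<^sub>F (y, t) in nhds x \<times>\<^sub>F at_right (0::real). P y t" and "0 < c"
  shows "\<forall>\<^sub>F (y, t) in nhds x \<times>\<^sub>F at_right 0. P y (c * t)"
proof -
  let ?F = "nhds x \<times>\<^sub>F at_right (0::real)"
  have y: "(fst \<longlongrightarrow> x) ?F" and t: "filterlim snd (at_right 0) ?F"
    by (rule filterlim_fst filterlim_snd)+
  have "filterlim (\<lambda>t. c * t) (at_right 0) (at_right 0)"
    using filterlim_times_pos[of "\<lambda>t. t" 0 "at_right 0" c 0] assms(2) by (simp add: filterlim_ident)
  from filterlim_compose[OF this t] y have "filterlim (\<lambda>z. (fst z, c * snd z)) ?F ?F"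
    by (intro filterlim_Pair) simp_all
  from eventually_compose_filterlim[OF assms(1) this] show ?thesis
    by (simp add: case_prod_unfold)
qed

lemma clarke_dderiv_lessD:
  assumes "clarke_dderiv f x h < c"
  shows "\<forall>\<^sub>F (y, t) in nhds x \<times>\<^sub>F at_right 0. ereal ((f (y + t *\<^sub>R h) - f y) / t) < c"
  using Limsup_lessD[OF assms[unfolded clarke_dderiv_def]] by (simp add: case_prod_unfold)

lemma clarke_dderiv_leI:
  assumes "\<forall>\<^sub>F (y, t) in nhds x \<times>\<^sub>F at_right 0. ereal ((f (y + t *\<^sub>R h) - f y) / t) \<le> c"
  shows "clarke_dderiv f x h \<le> c"
  unfolding clarke_dderiv_def using assms by (intro Limsup_bounded) (simp add: case_prod_unfold)

lemma eventually_at_right_pos_prod: "\<forall>\<^sub>F (y, t) in F \<times>\<^sub>F at_right (0::real). 0 < t"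
  unfolding eventually_prod_filter
  by (intro exI[of _ "\<lambda>_. True"] exI[of _ "\<lambda>t. 0 < t"]) (auto simp: eventually_at_right_less)

lemma eventually_nhds_prod1:
  assumes "open U" "x \<in> U"
  shows "\<forall>\<^sub>F (y, t) in nhds x \<times>\<^sub>F F. y \<in> U"
  unfolding eventually_prod_filter
  using eventually_nhds_in_open[OF assms] by (intro exI[of _ "\<lambda>y. y \<in> U"] exI[of _ "\<lambda>_. True"]) auto

text \<open>Eventually both \<open>y\<close> and \<open>y + t *\<^sub>R h\<close> lie in
  \<open>U\<close>, so every quotient is bounded by \<open>L * norm h\<close> in absolute value. The
  lower estimate passes through the limit inferior and needs a nontrivial filter.\<close>

lemma clarke_dderiv_bound:
  assumes L: "L-lipschitz_on U f" and U: "open U" "x \<in> U"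
  shows "\<bar>clarke_dderiv f x h\<bar> \<le> ereal (L * norm h)"
proof -
  let ?F = "nhds x \<times>\<^sub>F at_right (0::real)"
  have "\<forall>\<^sub>F (y, t) in ?F. y \<in> U"
    by (rule eventually_nhds_prod1[OF U])
  moreover from this have "\<forall>\<^sub>F (y, t) in ?F. y + t *\<^sub>R h \<in> U"
    by (rule eventually_nhds_at_right_translate)
  moreover have "\<forall>\<^sub>F (y, t) in ?F. 0 < t"
    by (rule eventually_at_right_pos_prod)
  ultimately have ev: "\<forall>\<^sub>F (y, t) in ?F. \<bar>(f (y + t *\<^sub>R h) - f y) / t\<bar> \<le> L * norm h"
  proof eventually_elim
    case (elim z)
    then show ?case
      using lipschitz_on_normD[OF L, of "fst z + snd z *\<^sub>R h" "fst z"]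
      by (auto simp: field_simps split: prod.splits)
  qed
  have "clarke_dderiv f x h \<le> ereal (L * norm h)"
    by (rule clarke_dderiv_leI, rule eventually_mono[OF ev]) (auto simp: abs_le_iff simp del: abs_divide)
  moreover have "?F \<noteq> bot"
    by (simp add: prod_filter_eq_bot)
  then have "- ereal (L * norm h) \<le> clarke_dderiv f x h"
    unfolding clarke_dderiv_def
    by (intro order_trans[OF Liminf_bounded Liminf_le_Limsup] eventually_mono[OF ev])
      (auto simp: abs_le_iff simp del: abs_divide)
  ultimately show ?thesis
    by (cases "clarke_dderiv f x h") auto
qed

text \<open>The Lipschitz bound makes the derivative real-valued. For subadditivity the increment
  along \<open>h + g\<close> is split at \<open>y + t *\<^sub>R h\<close>; for homogeneity
  \<open>t\<close> is replaced by \<open>c * t\<close>.\<close>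

lemma clarke_dderiv_sublinear:
  assumes L: "L-lipschitz_on U f" and U: "open U" "x \<in> U"
  obtains p where "sublinear p" "\<And>h. \<bar>p h\<bar> \<le> L * norm h" "\<And>h. clarke_dderiv f x h = ereal (p h)"
proof -
  define p where "p h = real_of_ereal (clarke_dderiv f x h)" for h
  have p: "clarke_dderiv f x h = ereal (p h)" for h
    unfolding p_def using clarke_dderiv_bound[OF assms, of h]
    by (cases "clarke_dderiv f x h") auto
  have less: "\<forall>\<^sub>F (y, t) in nhds x \<times>\<^sub>F at_right 0. (f (y + t *\<^sub>R h) - f y) / t < r" if "p h < r" for h r
    using clarke_dderiv_lessD[of f x h "ereal r"] that by (simp add: p)
  have le: "p h \<le> r" if "\<forall>\<^sub>F (y, t) in nhds x \<times>\<^sub>F at_right 0. (f (y + t *\<^sub>R h) - f y) / t \<le> r" for h r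
    using clarke_dderiv_leI[of f h "ereal r" x] that by (simp add: p)
  have "p (h + g) \<le> p h + p g" for h g
  proof (rule field_le_epsilon)
    fix e :: real assume "0 < e"
    have "\<forall>\<^sub>F (y, t) in nhds x \<times>\<^sub>F at_right 0. (f (y + t *\<^sub>R h) - f y) / t < p h + e / 2"
      using \<open>0 < e\<close> by (intro less) simp
    moreover have "\<forall>\<^sub>F (y, t) in nhds x \<times>\<^sub>F at_right 0. (f (y + t *\<^sub>R g) - f y) / t < p g + e / 2"
      using \<open>0 < e\<close> by (intro less) simp
    then have "\<forall>\<^sub>F (y, t) in nhds x \<times>\<^sub>F at_right 0.
        (f (y + t *\<^sub>R h + t *\<^sub>R g) - f (y + t *\<^sub>R h)) / t < p g + e / 2"
      by (rule eventually_nhds_at_right_translate)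
    ultimately have "\<forall>\<^sub>F (y, t) in nhds x \<times>\<^sub>F at_right 0. (f (y + t *\<^sub>R (h + g)) - f y) / t \<le> p h + p g + e"
      by eventually_elim (auto simp: diff_divide_distrib algebra_simps)
    then show "p (h + g) \<le> p h + p g + e" by (rule le)
  qed
  moreover have scale_le: "p (c *\<^sub>R h) \<le> c * p h" if c: "0 < c" for c h
  proof (rule field_le_epsilon)
    fix e :: real assume "0 < e"
    then have "\<forall>\<^sub>F (y, t) in nhds x \<times>\<^sub>F at_right 0. (f (y + t *\<^sub>R h) - f y) / t < p h + e / c"
      using c by (intro less) simp
    then have "\<forall>\<^sub>F (y, t) in nhds x \<times>\<^sub>F at_right 0. (f (y + (c * t) *\<^sub>R h) - f y) / (c * t) < p h + e / c"
      using c by (rule eventually_nhds_at_right_scale)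
    moreover have "\<forall>\<^sub>F (y, t) in nhds x \<times>\<^sub>F at_right (0::real). 0 < t"
      by (rule eventually_at_right_pos_prod)
    ultimately have "\<forall>\<^sub>F (y, t) in nhds x \<times>\<^sub>F at_right 0. (f (y + t *\<^sub>R c *\<^sub>R h) - f y) / t \<le> c * p h + e"
    proof eventually_elim
      case (elim z)
      obtain y t where z: "z = (y, t)" by force
      have "(f (y + t *\<^sub>R c *\<^sub>R h) - f y) / t = c * ((f (y + (c * t) *\<^sub>R h) - f y) / (c * t))"
        using c by (simp add: mult.commute)
      also have "\<dots> \<le> c * (p h + e / c)"
        using elim c z by (intro mult_left_mono) auto
      finally show ?case
        using c z by (simp add: distrib_left)
    qed
    then show "p (c *\<^sub>R h) \<le> c * p h + e" by (rule le)
  qed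
  have "p (c *\<^sub>R h) = c * p h" if c: "0 < c" for c h
    using scale_le[OF c, of h] scale_le[of "inverse c" "c *\<^sub>R h"] c by (simp add: field_simps)
  ultimately have "sublinear p" by (simp add: sublinear_def)
  moreover have "\<bar>p h\<bar> \<le> L * norm h" for h
    using clarke_dderiv_bound[OF assms, of h] by (simp add: p)
  ultimately show thesis using p by (rule that)
qed

section \<open>Dependence of the derivative on point and direction\<close>

lemma locally_lipschitzE:
  assumes "locally_lipschitz f"
  obtains U L where "open U" "x \<in> U" "L-lipschitz_on U f"
  using assms unfolding locally_lipschitz_def by (metis centre_in_ball open_ball)

text \<open>Write \<open>g = h + (g - h)\<close> and use subadditivity. The constant
  \<open>L\<close> is the same for all points of \<open>U\<close>, which the joint semicontinuity
  relies on.\<close>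

lemma clarke_dderiv_le_add:
  assumes "L-lipschitz_on U f" "open U" "x \<in> U"
  shows "clarke_dderiv f x g \<le> clarke_dderiv f x h + ereal (L * norm (g - h))"
proof -
  obtain p where p: "sublinear p" "\<And>h. \<bar>p h\<bar> \<le> L * norm h" "\<And>h. clarke_dderiv f x h = ereal (p h)"
    using clarke_dderiv_sublinear[OF assms] by blast
  have "p g \<le> p h + L * norm (g - h)"
    using sublinear_add[OF p(1), of h "g - h"] p(2)[of "g - h"] by simp
  then show ?thesis by (simp add: p(3))
qed

lemma clarke_dderiv_tendsto:
  assumes "locally_lipschitz f" and h: "(h' \<longlongrightarrow> h) F"
  shows "((\<lambda>k. clarke_dderiv f x (h' k)) \<longlongrightarrow> clarke_dderiv f x h) F"
proof -
  obtain U L where U: "open U" "x \<in> U" "L-lipschitz_on U f"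
    using locally_lipschitzE[OF assms(1)] .
  obtain p where "sublinear p" "\<And>h. \<bar>p h\<bar> \<le> L * norm h"
    and p: "\<And>h. clarke_dderiv f x h = ereal (p h)"
    using clarke_dderiv_sublinear[OF U(3,1,2)] by blast
  have "p g \<le> p h + L * norm (g - h)" for g h
    using clarke_dderiv_le_add[OF U(3,1,2), of g h] by (simp add: p)
  then have "\<bar>p g - p h\<bar> \<le> L * norm (g - h)" for g h
    by (smt (verit) norm_minus_commute)
  then have "\<forall>\<^sub>F k in F. norm (p (h' k) - p h) \<le> L * norm (h' k - h)"
    by (intro always_eventually allI) simp
  moreover have "((\<lambda>k. L * norm (h' k - h)) \<longlongrightarrow> 0) F"
    by (intro tendsto_mult_right_zero tendsto_norm_zero LIM_zero h)
  ultimately have "((\<lambda>k. p (h' k) - p h) \<longlongrightarrow> 0) F"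
    by (rule Lim_null_comparison)
  then show ?thesis
    by (simp add: p LIM_zero_iff)
qed

text \<open>A strict bound on the quotients near \<open>x\<close> holds on a product neighborhood,
  and the same neighborhood serves every base point close to \<open>x\<close>. The change of
  direction is then absorbed by the Lipschitz estimate.\<close>

lemma clarke_dderiv_upper_semicontinuous:
  assumes "locally_lipschitz f"
  shows "open {(y, g). clarke_dderiv f y g < c}"
proof (subst open_subopen, intro ballI)
  fix z assume "z \<in> {(y, g). clarke_dderiv f y g < c}"
  then obtain x h where z: "z = (x, h)" and less: "clarke_dderiv f x h < c"
    by auto
  obtain U L where U: "open U" "x \<in> U" "L-lipschitz_on U f"
    using locally_lipschitzE[OF assms] .
  obtain p where "sublinear p" "\<And>h. \<bar>p h\<bar> \<le> L * norm h"
    and p: "\<And>h. clarke_dderiv f x h = ereal (p h)"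
    using clarke_dderiv_sublinear[OF U(3,1,2)] by blast
  \<comment> \<open>Two levels are inserted below \<open>c\<close>: \<open>r\<close> bounds the
    derivative in direction \<open>h\<close> at nearby points, and \<open>s - r\<close> is left for
    the change of direction.\<close>
  obtain s where s: "ereal (p h) < ereal s" "ereal s < c"
    using ereal_dense2[OF less[unfolded p]] by blast
  obtain r where r: "p h < r" "r < s"
    using s(1) dense by auto
  have "\<forall>\<^sub>F (y, t) in nhds x \<times>\<^sub>F at_right 0. ereal ((f (y + t *\<^sub>R h) - f y) / t) < ereal r"
    using r(1) by (intro clarke_dderiv_lessD) (simp add: p)
  then obtain P Q where PQ: "\<forall>\<^sub>F y in nhds x. P y" "\<forall>\<^sub>F t in at_right 0. Q t"
    "\<And>y t. P y \<Longrightarrow> Q t \<Longrightarrow> (f (y + t *\<^sub>R h) - f y) / t < r"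
    unfolding eventually_prod_filter by auto
  obtain V where V: "open V" "x \<in> V" "\<And>y. y \<in> V \<Longrightarrow> P y"
    using PQ(1) unfolding eventually_nhds by auto
  have le: "clarke_dderiv f y h \<le> ereal r" if "y \<in> V" for y
  proof (rule clarke_dderiv_leI)
    have "\<forall>\<^sub>F z in nhds y. P z"
      using that V unfolding eventually_nhds by auto
    with PQ(2) have "\<forall>\<^sub>F z in nhds y \<times>\<^sub>F at_right 0. P (fst z) \<and> Q (snd z)"
      by (rule eventually_prodI[rotated])
    then show "\<forall>\<^sub>F (z, t) in nhds y \<times>\<^sub>F at_right 0. ereal ((f (z + t *\<^sub>R h) - f z) / t) \<le> ereal r"
      by eventually_elim (use PQ(3) in \<open>auto intro: less_imp_le\<close>)
  qed
  define W where "W = {g. L * norm (g - h) < s - r}"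
  have "open W"
    unfolding W_def by (intro open_Collect_less continuous_intros)
  moreover have "h \<in> W" using r(2) by (simp add: W_def)
  moreover have "clarke_dderiv f y g < c" if "y \<in> U \<inter> V" "g \<in> W" for y g
  proof -
    have "clarke_dderiv f y g \<le> clarke_dderiv f y h + ereal (L * norm (g - h))"
      using that U by (intro clarke_dderiv_le_add) auto
    also have "\<dots> \<le> ereal r + ereal (s - r)"
      using that le[of y] by (intro add_mono) (auto simp: W_def)
    also have "\<dots> < c" using s(2) by simp
    finally show ?thesis .
  qed
  ultimately show "\<exists>T. open T \<and> z \<in> T \<and> T \<subseteq> {(y, g). clarke_dderiv f y g < c}"
    using z U(1,2) V(1,2) by (intro exI[of _ "(U \<inter> V) \<times> W"]) (auto intro: open_Times)
qed

text \<open>A linear functional supporting the derivative at \<open>h\<close> inherits its bound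
  \<open>L * norm y\<close>, by comparison at \<open>y\<close> and \<open>- y\<close>, and so
  belongs to the dual space.\<close>

lemma clarke_dderiv_attained:
  assumes "locally_lipschitz f"
  obtains a where "a \<in> clarke_gradient f x" "ereal (blinfun_apply a h) = clarke_dderiv f x h"
proof -
  obtain U L where U: "open U" "x \<in> U" "L-lipschitz_on U f"
    using locally_lipschitzE[OF assms] .
  obtain p where p: "sublinear p" "\<And>h. \<bar>p h\<bar> \<le> L * norm h" "\<And>h. clarke_dderiv f x h = ereal (p h)"
    using clarke_dderiv_sublinear[OF U(3,1,2)] by blast
  obtain g where g: "linear g" "g \<le> p" "g h = p h"
    using Hahn_Banach_supporting_functional[OF p(1)] .
  have "\<bar>g y\<bar> \<le> norm y * L" for y
    using le_funD[OF g(2), of y] le_funD[OF g(2), of "- y"] p(2)[of y] p(2)[of "- y"]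
      linear_neg[OF g(1), of y] by (simp add: mult.commute)
  then have "bounded_linear g"
    using g(1) by (auto simp: linear_iff intro!: bounded_linear_intro)
  then have "blinfun_apply (Blinfun g) = g"
    by (rule bounded_linear_Blinfun_apply)
  then show thesis
    using g by (intro that[of "Blinfun g"]) (auto simp: clarke_gradient_def p(3) le_fun_def)
qed

section \<open>Gradients and derivatives on sets\<close>

text \<open>For fixed \<open>h\<close> the inequality describes a convex, weak* closed set that
  contains the gradient at each point of \<open>A\<close>, hence also the closed convex
  hull.\<close>

lemma clarke_gradient_on_le:
  assumes "a \<in> clarke_gradient_on f A"
  shows "ereal (blinfun_apply a h) \<le> clarke_dderiv_on f A h"
proof -
  define T where "T = {a. ereal (blinfun_apply a h) \<le> clarke_dderiv_on f A h}"
  have "(\<Union>y\<in>A. clarke_gradient f y) \<subseteq> T"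
    by (auto simp: T_def clarke_gradient_def clarke_dderiv_on_def intro: SUP_upper2)
  moreover have "convex T"
  proof (rule convexI)
    fix a b u v assume ab: "a \<in> T" "b \<in> T" and uv: "0 \<le> u" "0 \<le> v" "u + v = (1::real)"
    \<comment> \<open>Passing to the maximum keeps the convexity argument in the reals, as the
      supremum on the right may be infinite.\<close>
    have "u * blinfun_apply a h + v * blinfun_apply b h
        \<le> max (blinfun_apply a h) (blinfun_apply b h)"
      using uv by (intro convex_bound_le) auto
    then have "ereal (blinfun_apply (u *\<^sub>R a + v *\<^sub>R b) h)
        \<le> ereal (max (blinfun_apply a h) (blinfun_apply b h))"
      by (simp add: blinfun.add_left blinfun.scaleR_left del: ereal_max)
    also have "\<dots> \<le> clarke_dderiv_on f A h"
      using ab by (auto simp: T_def max_def)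
    finally show "u *\<^sub>R a + v *\<^sub>R b \<in> T" by (simp add: T_def)
  qed
  moreover have "closedin weak_star_topology T"
  proof -
    have "closed {r. ereal r \<le> clarke_dderiv_on f A h}"
      by (intro closed_Collect_le continuous_intros)
    then show ?thesis
      using closedin_continuous_map_preimage[OF strong_operator_topology_continuous_evaluation[of h]]
      by (force simp: T_def strong_operator_topology_topspace)
  qed
  ultimately have "clarke_gradient_on f A \<subseteq> T"
    unfolding clarke_gradient_on_def by (intro closure_of_minimal hull_minimal)
  with assms show ?thesis by (auto simp: T_def)
qed

text \<open>By upper semicontinuity the strict sublevel sets at the levels \<open>n\<close> are
  open; they cover \<open>A\<close>, and finitely many suffice.\<close>

lemma clarke_dderiv_on_bounded_above:
  assumes "locally_lipschitz f" "compact A"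
  obtains K :: real where "clarke_dderiv_on f A h \<le> ereal K"
proof -
  define O' where "O' n = {y. clarke_dderiv f y h < ereal (real n)}" for n
  have "open (O' n)" for n
  proof -
    have "O' n = (\<lambda>y. (y, h)) -` {(y, g). clarke_dderiv f y g < ereal (real n)}"
      by (auto simp: O'_def)
    also have "open \<dots>"
      by (intro open_vimage clarke_dderiv_upper_semicontinuous assms(1) continuous_intros)
    finally show ?thesis .
  qed
  moreover have "A \<subseteq> (\<Union>n. O' n)"
  proof
    fix y
    obtain U L where "open U" "y \<in> U" "L-lipschitz_on U f"
      using locally_lipschitzE[OF assms(1)] .
    then obtain p where "\<And>h. clarke_dderiv f y h = ereal (p h)"
      using clarke_dderiv_sublinear by metis
    moreover obtain n where "p h < real n" using reals_Archimedean2 by blast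
    ultimately show "y \<in> (\<Union>n. O' n)" by (auto simp: O'_def)
  qed
  ultimately obtain N where N: "finite N" "A \<subseteq> (\<Union>n\<in>N. O' n)"
    using compactE_image[OF assms(2), of UNIV O'] by auto
  have "clarke_dderiv f y h \<le> ereal (real (Max N))" if y: "y \<in> A" for y
  proof -
    obtain n where n: "n \<in> N" "y \<in> O' n" using y N(2) by auto
    then have "clarke_dderiv f y h \<le> ereal (real n)" by (auto simp: O'_def)
    also have "\<dots> \<le> ereal (real (Max N))" using n(1) N(1) by simp
    finally show ?thesis .
  qed
  then show thesis
    by (intro that[of "real (Max N)"]) (auto simp: clarke_dderiv_on_def intro: SUP_least)
qed

text \<open>If \<open>a\<close> were outside, some \<open>x\<close> would separate it from all
  gradients by a gap \<open>e\<close>. Each derivative in direction \<open>x\<close> is attained by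
  a gradient, so the supremum over \<open>A\<close> would be at most
  \<open>\<langle>a, x\<rangle> - e\<close>.\<close>

theorem mem_clarke_gradient_on_iff:
  assumes f: "locally_lipschitz f" and A: "compact A" "A \<noteq> {}"
  shows "a \<in> clarke_gradient_on f A \<longleftrightarrow> (\<forall>h. ereal (blinfun_apply a h) \<le> clarke_dderiv_on f A h)"
proof
  assume le: "\<forall>h. ereal (blinfun_apply a h) \<le> clarke_dderiv_on f A h"
  define S where "S = convex hull (\<Union>y\<in>A. clarke_gradient f y)"
  have grad_S: "b \<in> S" if "b \<in> clarke_gradient f y" "y \<in> A" for b y
    unfolding S_def using that by (intro hull_inc) auto
  have S_le: "ereal (blinfun_apply b h) \<le> clarke_dderiv_on f A h" if "b \<in> S" for b h
    using that unfolding S_def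
    by (intro clarke_gradient_on_le) (auto simp: clarke_gradient_on_def
        strong_operator_topology_topspace intro: subsetD[OF closure_of_subset])
  show "a \<in> clarke_gradient_on f A"
  proof (rule ccontr)
    assume "a \<notin> clarke_gradient_on f A"
    then have "a \<notin> weak_star_topology closure_of S"
      by (simp add: clarke_gradient_on_def S_def)
    moreover obtain y where "y \<in> A" using A(2) by auto
    then have "S \<noteq> {}"
      using grad_S clarke_dderiv_attained[OF f, of y] by (metis empty_iff)
    moreover have "bounded ((\<lambda>c. blinfun_apply c x) ` S)" for x
    proof -
      \<comment> \<open>Upper bounds in the directions \<open>x\<close> and \<open>- x\<close> give
        a two-sided bound on the evaluations at \<open>x\<close>.\<close>
      obtain K1 K2 where K: "clarke_dderiv_on f A x \<le> ereal K1" "clarke_dderiv_on f A (- x) \<le> ereal K2"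
        using clarke_dderiv_on_bounded_above[OF f A(1)] by metis
      have "blinfun_apply c x \<in> {- K2..K1}" if "c \<in> S" for c
        using order_trans[OF S_le[OF that] K(1)] order_trans[OF S_le[OF that] K(2)]
        by (simp add: blinfun.minus_right)
      then show ?thesis
        by (intro bounded_subset[OF bounded_closed_interval[of "- K2" K1]]) auto
    qed
    moreover have "convex S" by (simp add: S_def)
    ultimately obtain x e where e: "e > 0"
      and sep: "\<And>c. c \<in> S \<Longrightarrow> blinfun_apply c x + e \<le> blinfun_apply a x"
      using weak_star_separation by metis
    have "clarke_dderiv f y x \<le> ereal (blinfun_apply a x - e)" if "y \<in> A" for y
    proof -
      obtain b where "b \<in> clarke_gradient f y" "ereal (blinfun_apply b x) = clarke_dderiv f y x"
        using clarke_dderiv_attained[OF f] .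
      then show ?thesis
        using sep[OF grad_S[OF _ that]] by (metis ereal_less_eq(3) le_diff_eq)
    qed
    then have "clarke_dderiv_on f A x \<le> ereal (blinfun_apply a x - e)"
      unfolding clarke_dderiv_on_def by (rule SUP_least)
    with le have "ereal (blinfun_apply a x) \<le> ereal (blinfun_apply a x - e)"
      using order_trans by blast
    with e show False by simp
  qed
qed (simp add: clarke_gradient_on_le)

lemma clarke_gradient_on_mono:
  assumes "A \<subseteq> B"
  shows "clarke_gradient_on f A \<subseteq> clarke_gradient_on f B"
  unfolding clarke_gradient_on_def using assms by (intro closure_of_mono hull_mono) auto

section \<open>Hausdorff convergence and upper limits\<close>

lemma hausdorff_distance_tendsto_imp_subset:
  assumes "((\<lambda>k. hausdorff_distance (S k) A) \<longlongrightarrow> 0) F" "0 < e"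
  shows "\<forall>\<^sub>F k in F. S k \<subseteq> set_neighborhood e A"
proof -
  have "\<forall>\<^sub>F k in F. hausdorff_distance (S k) A < ereal e"
    using assms by (intro order_tendstoD(2)) auto
  then show ?thesis
  proof eventually_elim
    case (elim k)
    then obtain d where "d < e" "S k \<subseteq> set_neighborhood d A"
      by (auto simp: hausdorff_distance_def Inf_less_iff)
    then show ?case by (force simp: set_neighborhood_def)
  qed
qed

text \<open>The open sublevel set \<open>W\<close> contains the compact set
  \<open>A \<times> {h}\<close>, hence a uniform neighborhood of it, and
  \<open>S k \<times> {h' k}\<close> eventually lies in that neighborhood.\<close>

theorem clarke_dderiv_on_Limsup_le:
  assumes f: "locally_lipschitz f" and A: "compact A"
    and h: "(h' \<longlongrightarrow> h) F" and S: "((\<lambda>k. hausdorff_distance (S k) A) \<longlongrightarrow> 0) F"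
  shows "Limsup F (\<lambda>k. clarke_dderiv_on f (S k) (h' k)) \<le> clarke_dderiv_on f A h"
  unfolding Limsup_le_iff
proof (intro allI impI)
  fix d assume "clarke_dderiv_on f A h < d"
  \<comment> \<open>The supremum over \<open>S k\<close> preserves only the weak inequality with
    \<open>c\<close>; the gap between \<open>c\<close> and \<open>d\<close> restores
    strictness.\<close>
  then obtain c where c: "clarke_dderiv_on f A h < c" "c < d"
    using dense by blast
  define W where "W = {(y, g). clarke_dderiv f y g < c}"
  have "compact (A \<times> {h})" "open W"
    unfolding W_def using A clarke_dderiv_upper_semicontinuous[OF f] by (auto intro: compact_Times)
  moreover have "A \<times> {h} \<subseteq> W"
  proof -
    have "clarke_dderiv f y h < c" if "y \<in> A" for y
      using SUP_upper[OF that, of "\<lambda>y. clarke_dderiv f y h"] c(1)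
      unfolding clarke_dderiv_on_def by (rule le_less_trans)
    then show ?thesis by (auto simp: W_def)
  qed
  ultimately obtain e where e: "e > 0" "(\<Union>z\<in>A \<times> {h}. ball z e) \<subseteq> W"
    by (rule compact_subset_open_imp_ball_epsilon_subset)
  have "\<forall>\<^sub>F k in F. S k \<subseteq> set_neighborhood (e / 2) A"
    using e(1) by (intro hausdorff_distance_tendsto_imp_subset[OF S]) simp
  moreover have "\<forall>\<^sub>F k in F. dist (h' k) h < e / 2"
    using e(1) by (intro tendstoD[OF h]) simp
  ultimately show "\<forall>\<^sub>F k in F. clarke_dderiv_on f (S k) (h' k) < d"
  proof eventually_elim
    case (elim k)
    have "clarke_dderiv f y (h' k) \<le> c" if y: "y \<in> S k" for y
    proof -
      obtain x where x: "x \<in> A" "dist x y < e / 2"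
        using elim(1) y by (auto simp: set_neighborhood_def)
      have "dist (x, h) (y, h' k) \<le> dist x y + dist h (h' k)"
        unfolding dist_Pair_Pair by (rule sqrt_sum_squares_le_sum) auto
      then have "(y, h' k) \<in> ball (x, h) e"
        using x(2) elim(2) by (simp add: dist_commute)
      with e(2) x(1) have "(y, h' k) \<in> W" by blast
      then show ?thesis by (auto simp: W_def)
    qed
    then have "clarke_dderiv_on f (S k) (h' k) \<le> c"
      unfolding clarke_dderiv_on_def by (rule SUP_least)
    with c(2) show ?case by simp
  qed
qed

theorem proposition2p6:
  fixes f :: "'a::banach \<Rightarrow> real"
    and h :: 'a and h_seq :: "nat \<Rightarrow> 'a"
    and A :: "'a set" and A_seq :: "nat \<Rightarrow> 'a set"
  assumes "locally_lipschitz f"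
    and "h_seq \<longlonglongrightarrow> h"
    and "\<And>k. A_seq k \<noteq> {}"
    and "A \<noteq> {}"
    and "compact A"
    and "(\<lambda>k. hausdorff_distance (A_seq k) A) \<longlonglongrightarrow> 0"
  shows "limsup (\<lambda>k. clarke_dderiv_on f (A_seq k) (h_seq k)) \<le> clarke_dderiv_on f A h
    \<and> {a. \<exists>a_seq. (\<forall>k. a_seq k \<in> clarke_gradient_on f (A_seq k))
                \<and> limitin weak_star_topology a_seq a sequentially}
        \<subseteq> clarke_gradient_on f A
    \<and> ((\<forall>k. A \<subseteq> A_seq k) \<longrightarrow>
         {a. \<exists>a_seq. (\<forall>k. a_seq k \<in> clarke_gradient_on f (A_seq k))
                   \<and> limitin weak_star_topology a_seq a sequentially}
           = clarke_gradient_on f A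
         \<and> (\<lambda>k. clarke_dderiv_on f (A_seq k) (h_seq k)) \<longlonglongrightarrow> clarke_dderiv_on f A h)"
    (is "_ \<and> ?limits \<subseteq> _ \<and> _")
proof -
  \<comment> \<open>The direction sequence stays open: the estimate is used for \<open>h_seq\<close>
    and for constant directions \<open>g\<close>.\<close>
  note usc = clarke_dderiv_on_Limsup_le[OF assms(1,5) _ assms(6)]
  have limits: "?limits \<subseteq> clarke_gradient_on f A"
  proof clarify
    fix a a_seq
    assume a_seq: "\<forall>k. a_seq k \<in> clarke_gradient_on f (A_seq k)"
      and lim: "limitin weak_star_topology a_seq a sequentially"
    have "ereal (blinfun_apply a g) \<le> clarke_dderiv_on f A g" for g
    proof -
      have "(\<lambda>k. ereal (blinfun_apply (a_seq k) g)) \<longlonglongrightarrow> ereal (blinfun_apply a g)"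
        using lim by (simp add: limitin_weak_star_iff)
      then have "ereal (blinfun_apply a g) = limsup (\<lambda>k. ereal (blinfun_apply (a_seq k) g))"
        by (intro lim_imp_Limsup[symmetric]) simp_all
      also have "\<dots> \<le> limsup (\<lambda>k. clarke_dderiv_on f (A_seq k) g)"
        using a_seq by (intro Limsup_mono always_eventually) (auto intro: clarke_gradient_on_le)
      also have "\<dots> \<le> clarke_dderiv_on f A g"
        by (rule usc) simp
      finally show ?thesis .
    qed
    then show "a \<in> clarke_gradient_on f A"
      using mem_clarke_gradient_on_iff[OF assms(1,5,4)] by blast
  qed
  \<comment> \<open>Monotonicity in the set makes the constant sequence \<open>a\<close>
    admissible.\<close>
  moreover have "clarke_gradient_on f A \<subseteq> ?limits" if "\<forall>k. A \<subseteq> A_seq k"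
  proof
    fix a assume "a \<in> clarke_gradient_on f A"
    then have "\<forall>k. a \<in> clarke_gradient_on f (A_seq k)"
      using that clarke_gradient_on_mono by blast
    then show "a \<in> ?limits"
      by (auto simp: limitin_weak_star_iff intro!: exI[of _ "\<lambda>_. a"])
  qed
  moreover have "(\<lambda>k. clarke_dderiv_on f (A_seq k) (h_seq k)) \<longlonglongrightarrow> clarke_dderiv_on f A h"
    if sub: "\<forall>k. A \<subseteq> A_seq k"
  proof (rule order_tendstoI)
    \<comment> \<open>For the lower estimate one point \<open>y\<close> of \<open>A\<close> whose
      derivative exceeds \<open>c\<close> is kept fixed. It lies in every \<open>A_seq k\<close>,
      and continuity in the direction preserves the strict inequality.\<close>
    fix c assume "c < clarke_dderiv_on f A h"
    then obtain y where y: "y \<in> A" "c < clarke_dderiv f y h"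
      by (auto simp: clarke_dderiv_on_def less_SUP_iff)
    have "\<forall>\<^sub>F k in sequentially. c < clarke_dderiv f y (h_seq k)"
      using y(2) clarke_dderiv_tendsto[OF assms(1,2)] by (rule order_tendstoD(1)[rotated])
    then show "\<forall>\<^sub>F k in sequentially. c < clarke_dderiv_on f (A_seq k) (h_seq k)"
      by eventually_elim (use y(1) sub in \<open>auto simp: clarke_dderiv_on_def less_SUP_iff\<close>)
  qed (use usc[OF assms(2)] in \<open>auto intro: Limsup_lessD\<close>)
  ultimately show ?thesis
    using usc[OF assms(2)] by blast
qed

end
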